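(* Let $\mathbb{K}$ be a field of characteristic zero and $R$ a unital commutative associative $\mathbb{K}$-algebra. If $X,Y\in T_R$ and there exists $c\in R$ satisfying $$[X,[X,Y]]=cY,$$ then the bracket $$[\alpha_1,\alpha_2]:=\langle\alpha_1,Y\rangle\pounds_X\alpha_2-\langle\alpha_2,Y\rangle\pounds_X\alpha_1-\langle\alpha_1,[X,Y]\rangle\alpha_2+\langle\alpha_2,[X,Y]\rangle\alpha_1\qquad(\alpha_1,\alpha_2\in\Omega^1_R)$$ gives a Lie-Rinehart algebra structure on $\Omega^1_R$ with the anchor $\rho\colon\Omega^1_R\to T_R$, $\rho(\alpha):=\langle\alpha,Y\rangle X$.
   Context: $T_R:=\mathrm{Der}(R)$ is the $R$-module and Lie algebra (under commutators) of all $\mathbb{K}$-linear derivations $R\to R$; $\Omega^1_R:=\mathrm{Hom}_R(T_R,R)$; $\langle\alpha,X\rangle:=\alpha(X)$ for $\alpha\in\Omega^1_R$, $X\in T_R$. For $X\in T_R$ the Lie derivative $\pounds_X\colon\Omega^1_R\to\Omega^1_R$ is $(\pounds_X\alpha)(Z):=X(\alpha(Z))-\alpha([X,Z])$ for $Z\in T_R$. A Lie-Rinehart algebra structure (equivalently, $(\mathbb{K},R)$-Lie algebra structure) on a unital left $R$-module $L$ with an $R$-linear map $\rho\colon L\to T_R$ (the anchor) is a Lie algebra structure $[\cdot,\cdot]$ on $L$ over $\mathbb{K}$ such that $\rho$ is a Lie algebra homomorphism and $[\ell_1,r\cdot\ell_2]=r\cdot[\ell_1,\ell_2]+(\rho(\ell_1)r)\cdot\ell_2$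 for all $r\in R$, $\ell_1,\ell_2\in L$. *)

theory Defs
  imports "HOL-Algebra.Module"
begin

text \<open>
  Modules are HOL-Algebra records, which extend rings. In the modules built here only the fields
  carrier, zero, add and smult are meaningful; mult and one are left undefined.
\<close>

definition regular_module :: "('r, 'z) ring_scheme \<Rightarrow> ('r, 'r) module" where
  "regular_module R = \<lparr>carrier = carrier R, mult = mult R, one = \<one>\<^bsub>R\<^esub>,
     zero = \<zero>\<^bsub>R\<^esub>, add = add R, smult = mult R\<rparr>"

definition linear_maps ::
  "('r, 'z) ring_scheme \<Rightarrow> ('r, 'm, 'x) module_scheme \<Rightarrow> ('r, 'n, 'y) module_scheme \<Rightarrow> ('m \<Rightarrow> 'n) set"
  where
  "linear_maps R M N = {f \<in> carrier M \<rightarrow> carrier N.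
     (\<forall>x \<in> carrier M. \<forall>y \<in> carrier M. f (x \<oplus>\<^bsub>M\<^esub> y) = f x \<oplus>\<^bsub>N\<^esub> f y) \<and>
     (\<forall>r \<in> carrier R. \<forall>x \<in> carrier M. f (r \<odot>\<^bsub>M\<^esub> x) = r \<odot>\<^bsub>N\<^esub> f x)}"

text \<open>Extensionality makes HOL equality of functions agree with equality of maps on the carrier.\<close>

definition hom_module ::
  "('r, 'z) ring_scheme \<Rightarrow> ('r, 'm, 'x) module_scheme \<Rightarrow> ('r, 'n, 'y) module_scheme
     \<Rightarrow> ('r, 'm \<Rightarrow> 'n) module" where
  "hom_module R M N = \<lparr>carrier = linear_maps R M N \<inter> extensional (carrier M),
     mult = undefined, one = undefined,
     zero = (\<lambda>x \<in> carrier M. \<zero>\<^bsub>N\<^esub>),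
     add = (\<lambda>f g. \<lambda>x \<in> carrier M. f x \<oplus>\<^bsub>N\<^esub> g x),
     smult = (\<lambda>r f. \<lambda>x \<in> carrier M. r \<odot>\<^bsub>N\<^esub> f x)\<rparr>"

text \<open>
  The $K$-algebra \<open>R\<close> is a module record over \<open>K\<close>: \<open>k \<odot>\<^bsub>R\<^esub> r\<close> is the action of the scalar \<open>k\<close>,
  whereas the scalar multiplication of \<open>Der K R\<close> is by elements of \<open>R\<close>.
\<close>

definition derivations :: "('k, 'z) ring_scheme \<Rightarrow> ('k, 'r, 'x) module_scheme \<Rightarrow> ('r \<Rightarrow> 'r) set" where
  "derivations K R = {D \<in> linear_maps K R R \<inter> extensional (carrier R).
     \<forall>r \<in> carrier R. \<forall>s \<in> carrier R.
       D (r \<otimes>\<^bsub>R\<^esub> s) = D r \<otimes>\<^bsub>R\<^esub> s \<oplus>\<^bsub>R\<^esub> r \<otimes>\<^bsub>R\<^esub> D s}"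

definition Der :: "('k, 'z) ring_scheme \<Rightarrow> ('k, 'r, 'x) module_scheme \<Rightarrow> ('r, 'r \<Rightarrow> 'r) module" where
  "Der K R = \<lparr>carrier = derivations K R, mult = undefined, one = undefined,
     zero = (\<lambda>r \<in> carrier R. \<zero>\<^bsub>R\<^esub>),
     add = (\<lambda>D E. \<lambda>r \<in> carrier R. D r \<oplus>\<^bsub>R\<^esub> E r),
     smult = (\<lambda>s D. \<lambda>r \<in> carrier R. s \<otimes>\<^bsub>R\<^esub> D r)\<rparr>"

definition commutator :: "('r, 'z) ring_scheme \<Rightarrow> ('r \<Rightarrow> 'r) \<Rightarrow> ('r \<Rightarrow> 'r) \<Rightarrow> 'r \<Rightarrow> 'r" where
  "commutator R D E = (\<lambda>r \<in> carrier R. D (E r) \<ominus>\<^bsub>R\<^esub> E (D r))"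

definition Omega1 ::
  "('k, 'z) ring_scheme \<Rightarrow> ('k, 'r, 'x) module_scheme \<Rightarrow> ('r, ('r \<Rightarrow> 'r) \<Rightarrow> 'r) module" where
  "Omega1 K R = hom_module R (Der K R) (regular_module R)"

definition lie_derivative ::
  "('k, 'z) ring_scheme \<Rightarrow> ('k, 'r, 'x) module_scheme \<Rightarrow> ('r \<Rightarrow> 'r)
     \<Rightarrow> (('r \<Rightarrow> 'r) \<Rightarrow> 'r) \<Rightarrow> ('r \<Rightarrow> 'r) \<Rightarrow> 'r" where
  "lie_derivative K R X \<alpha> =
     (\<lambda>Z \<in> carrier (Der K R). X (\<alpha> Z) \<ominus>\<^bsub>R\<^esub> \<alpha> (commutator R X Z))"

text \<open>An $R$-module as a $K$-module, along the structure map \<open>k \<mapsto> k \<cdot> 1\<close> of the $K$-algebra \<open>R\<close>.\<close>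

definition restrict_scalars ::
  "('k, 'r, 'x) module_scheme \<Rightarrow> ('r, 'l, 'y) module_scheme \<Rightarrow> ('k, 'l) module" where
  "restrict_scalars R L = \<lparr>carrier = carrier L, mult = mult L, one = \<one>\<^bsub>L\<^esub>,
     zero = \<zero>\<^bsub>L\<^esub>, add = add L, smult = (\<lambda>k l. (k \<odot>\<^bsub>R\<^esub> \<one>\<^bsub>R\<^esub>) \<odot>\<^bsub>L\<^esub> l)\<rparr>"

locale lie_algebra = module K L
  for K :: "('k, 'z) ring_scheme" and L :: "('k, 'l, 'y) module_scheme" +
  fixes br :: "'l \<Rightarrow> 'l \<Rightarrow> 'l"
  assumes br_closed: "\<lbrakk>x \<in> carrier L; y \<in> carrier L\<rbrakk> \<Longrightarrow> br x y \<in> carrier L"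
    and br_add_left: "\<lbrakk>x \<in> carrier L; y \<in> carrier L; z \<in> carrier L\<rbrakk>
      \<Longrightarrow> br (x \<oplus>\<^bsub>L\<^esub> y) z = br x z \<oplus>\<^bsub>L\<^esub> br y z"
    and br_add_right: "\<lbrakk>x \<in> carrier L; y \<in> carrier L; z \<in> carrier L\<rbrakk>
      \<Longrightarrow> br x (y \<oplus>\<^bsub>L\<^esub> z) = br x y \<oplus>\<^bsub>L\<^esub> br x z"
    and br_smult_left: "\<lbrakk>k \<in> carrier K; x \<in> carrier L; y \<in> carrier L\<rbrakk>
      \<Longrightarrow> br (k \<odot>\<^bsub>L\<^esub> x) y = k \<odot>\<^bsub>L\<^esub> br x y"
    and br_smult_right: "\<lbrakk>k \<in> carrier K; x \<in> carrier L; y \<in> carrier L\<rbrakk>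
      \<Longrightarrow> br x (k \<odot>\<^bsub>L\<^esub> y) = k \<odot>\<^bsub>L\<^esub> br x y"
    and br_alternating: "x \<in> carrier L \<Longrightarrow> br x x = \<zero>\<^bsub>L\<^esub>"
    and br_jacobi: "\<lbrakk>x \<in> carrier L; y \<in> carrier L; z \<in> carrier L\<rbrakk>
      \<Longrightarrow> br x (br y z) \<oplus>\<^bsub>L\<^esub> br y (br z x) \<oplus>\<^bsub>L\<^esub> br z (br x y) = \<zero>\<^bsub>L\<^esub>"

text \<open>
  The anchor is required to be linear over \<open>R\<close>, so it is automatically linear over \<open>K\<close>, and
  being a Lie algebra homomorphism adds only compatibility with the brackets.
\<close>

locale lie_rinehart_algebra =
  scalars: algebra K R + module R L + lie_algebra K "restrict_scalars R L" br
  for K :: "('k, 'z) ring_scheme"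
    and R :: "('k, 'r, 'x) module_scheme"
    and L :: "('r, 'l, 'y) module_scheme"
    and br :: "'l \<Rightarrow> 'l \<Rightarrow> 'l" +
  fixes \<rho> :: "'l \<Rightarrow> 'r \<Rightarrow> 'r"
  assumes anchor_linear: "\<rho> \<in> linear_maps R L (Der K R)"
    and anchor_bracket: "\<lbrakk>x \<in> carrier L; y \<in> carrier L\<rbrakk>
      \<Longrightarrow> \<rho> (br x y) = commutator R (\<rho> x) (\<rho> y)"
    and leibniz: "\<lbrakk>r \<in> carrier R; x \<in> carrier L; y \<in> carrier L\<rbrakk>
      \<Longrightarrow> br x (r \<odot>\<^bsub>L\<^esub> y) = r \<odot>\<^bsub>L\<^esub> br x y \<oplus>\<^bsub>L\<^esub> (\<rho> x r) \<odot>\<^bsub>L\<^esub> y"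

end

theory Submission
  imports Defs
begin

text \<open>
  Write \<open>V = [X, Y]\<close> and let \<open>\<nabla>\<^sub>\<alpha> = \<alpha>(Y) \<cdot> \<L>\<^sub>X - \<alpha>(V)\<close>, an operator on $1$-forms (\<open>\<L>\<^sub>X\<close> is the Lie
  derivative). Grouping the four terms of the bracket by the form that is evaluated at \<open>Y\<close> or
  \<open>V\<close>, it becomes \<open>[\<alpha>, \<beta>] = \<nabla>\<^sub>\<alpha> \<beta> - \<nabla>\<^sub>\<beta> \<alpha>\<close>. The operator \<open>\<nabla>\<^sub>\<alpha>\<close> is \<open>R\<close>-linear in \<open>\<alpha>\<close>, and it satisfies
  the product rule over the derivation \<open>\<alpha>(Y) X\<close>: it is a connection along the anchor for which the
  bracket is torsion-free by construction.

  The whole structure follows once this connection is flat, \<open>\<nabla>\<close> of \<open>[\<alpha>, \<beta>]\<close> being the commutator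
  of \<open>\<nabla>\<^sub>\<alpha>\<close> and \<open>\<nabla>\<^sub>\<beta>\<close>. Flatness says exactly that the product \<open>\<nabla>\<^sub>\<alpha> \<beta>\<close> is left-symmetric, and the
  commutator of a left-symmetric product is a Lie bracket
  (\<open>lie_algebra_of_left_symmetric_product\<close>); the Leibniz rule of the bracket is the product rule of
  the connection (\<open>lie_rinehart_algebra_of_flat_connection\<close>).

  For flatness, commute two first-order operators:
  \<open>[f \<L>\<^sub>X - g, f' \<L>\<^sub>X - g'] = (f \<cdot> X f' - f' \<cdot> X f) \<L>\<^sub>X - (f \<cdot> X g' - f' \<cdot> X g)\<close>.
  With \<open>f = \<alpha>(Y)\<close>, \<open>g = \<alpha>(V)\<close> and \<open>f' = \<beta>(Y)\<close>, \<open>g' = \<beta>(V)\<close>, the two coefficients have to be the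
  values of \<open>[\<alpha>, \<beta>]\<close> at \<open>Y\<close> and at \<open>V\<close>. These values involve \<open>(\<L>\<^sub>X \<beta>)(Y) = X(\<beta>(Y)) - \<beta>(V)\<close> and
  \<open>(\<L>\<^sub>X \<beta>)(V) = X(\<beta>(V)) - \<beta>([X, V])\<close>. This is where \<open>[X, V] = c Y\<close> enters: it turns the last term
  into \<open>c \<beta>(Y)\<close>, which is symmetric after multiplication by \<open>\<alpha>(Y)\<close> and therefore cancels
  (\<open>nabla_commutator_at_V\<close>). The value at \<open>Y\<close> also gives the compatibility of the anchor with the
  brackets.
\<close>

section \<open>Identities in abelian groups and commutative rings\<close>

text \<open>
  Normalisation rules that make the method \<open>algebra\<close> cancel opposite summands in an abelian group,
  and so in a module.
\<close>

lemmas (in abelian_group) abelian_group_simprules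
  [algebra abelian_group "zero G" "add G" "a_inv G" "a_minus G"] =
  a_closed zero_closed a_inv_closed minus_closed a_assoc l_zero l_neg a_comm minus_eq
  r_zero r_neg r_neg2 r_neg1 minus_add minus_minus minus_zero a_lcomm

lemma (in abelian_group) add_diff_add:
  assumes "a \<in> carrier G" "b \<in> carrier G" "c \<in> carrier G" "d \<in> carrier G"
  shows "(a \<oplus> b) \<ominus> (c \<oplus> d) = (a \<ominus> c) \<oplus> (b \<ominus> d)"
  using assms by algebra

lemma (in abelian_group) add_add_swap:
  assumes "a \<in> carrier G" "b \<in> carrier G" "c \<in> carrier G" "d \<in> carrier G"
  shows "(a \<oplus> b) \<oplus> (c \<oplus> d) = (a \<oplus> c) \<oplus> (b \<oplus> d)"
  using assms by (simp add: a_ac)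

lemma (in abelian_group) diff_diff_add:
  assumes "a \<in> carrier G" "b \<in> carrier G" "c \<in> carrier G" "d \<in> carrier G"
  shows "a \<ominus> b \<ominus> c \<oplus> d = (a \<ominus> c) \<ominus> (b \<ominus> d)"
  using assms by algebra

text \<open>
  The Jacobi sum after left symmetry has been applied: \<open>a\<close>, \<open>c\<close>, \<open>e\<close> stand for the cyclic products
  \<open>x(yz)\<close>, \<open>y(zx)\<close>, \<open>z(xy)\<close>, and \<open>b\<close>, \<open>d\<close>, \<open>f\<close> for \<open>x(zy)\<close>, \<open>y(xz)\<close>, \<open>z(yx)\<close>.
\<close>

lemma (in abelian_group) left_symmetric_jacobi_sum:
  assumes "a \<in> carrier G" "b \<in> carrier G" "c \<in> carrier G"
    "d \<in> carrier G" "e \<in> carrier G" "f \<in> carrier G"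
  shows "(a \<ominus> b \<ominus> (c \<ominus> f)) \<oplus> (c \<ominus> d \<ominus> (e \<ominus> b)) \<oplus> (e \<ominus> f \<ominus> (a \<ominus> d)) = \<zero>"
  using assms by algebra

text \<open>
  The commutator of the operators \<open>f D - g\<close> and \<open>f' D - g'\<close>, for a map \<open>D\<close> with a product rule over a
  derivation of the ring, evaluated at one point: \<open>w\<close>, \<open>v\<close>, \<open>u\<close> are the values of an element and of its
  first and second image under \<open>D\<close>, and \<open>xf\<close> is the derivative of \<open>f\<close>. The second-order terms and the
  products \<open>g g'\<close> are symmetric and cancel.
\<close>

lemma (in cring) first_order_operator_commutator:
  assumes "f \<in> carrier R" "f' \<in> carrier R" "g \<in> carrier R" "g' \<in> carrier R"
    "xf \<in> carrier R" "xf' \<in> carrier R" "xg \<in> carrier R" "xg' \<in> carrier R"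
    "u \<in> carrier R" "v \<in> carrier R" "w \<in> carrier R"
  shows "(f \<otimes> xf' \<ominus> f' \<otimes> xf) \<otimes> v \<ominus> (f \<otimes> xg' \<ominus> f' \<otimes> xg) \<otimes> w =
    f \<otimes> (xf' \<otimes> v \<oplus> f' \<otimes> u \<ominus> (xg' \<otimes> w \<oplus> g' \<otimes> v)) \<ominus> g \<otimes> (f' \<otimes> v \<ominus> g' \<otimes> w)
    \<ominus> (f' \<otimes> (xf \<otimes> v \<oplus> f \<otimes> u \<ominus> (xg \<otimes> w \<oplus> g \<otimes> v)) \<ominus> g' \<otimes> (f \<otimes> v \<ominus> g \<otimes> w))"
  using assms by algebra

section \<open>Lie brackets from left-symmetric products\<close>

text \<open>
  Left symmetry rewrites each of the three terms of the Jacobi identity into four iterated products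
  with all brackets to the right; every one of the six products then occurs twice, with opposite
  signs. The bracket is a separate variable that agrees with the commutator of \<open>p\<close> on the carrier
  only, because a bracket between records is often given by a term that differs outside it.
\<close>

lemma lie_algebra_of_left_symmetric_product:
  fixes K :: "('k, 'z) ring_scheme" and L :: "('k, 'l, 'y) module_scheme" (structure)
  assumes "module K L"
    and closed: "\<And>x y. \<lbrakk>x \<in> carrier L; y \<in> carrier L\<rbrakk> \<Longrightarrow> p x y \<in> carrier L"
    and add_left: "\<And>x y z. \<lbrakk>x \<in> carrier L; y \<in> carrier L; z \<in> carrier L\<rbrakk>
      \<Longrightarrow> p (x \<oplus> y) z = p x z \<oplus> p y z"
    and add_right: "\<And>x y z. \<lbrakk>x \<in> carrier L; y \<in> carrier L; z \<in> carrier L\<rbrakk>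
      \<Longrightarrow> p x (y \<oplus> z) = p x y \<oplus> p x z"
    and smult_left: "\<And>k x y. \<lbrakk>k \<in> carrier K; x \<in> carrier L; y \<in> carrier L\<rbrakk>
      \<Longrightarrow> p (k \<odot> x) y = k \<odot> p x y"
    and smult_right: "\<And>k x y. \<lbrakk>k \<in> carrier K; x \<in> carrier L; y \<in> carrier L\<rbrakk>
      \<Longrightarrow> p x (k \<odot> y) = k \<odot> p x y"
    and left_symmetric: "\<And>x y z. \<lbrakk>x \<in> carrier L; y \<in> carrier L; z \<in> carrier L\<rbrakk>
      \<Longrightarrow> p (p x y \<ominus> p y x) z = p x (p y z) \<ominus> p y (p x z)"
    and br: "\<And>x y. \<lbrakk>x \<in> carrier L; y \<in> carrier L\<rbrakk> \<Longrightarrow> br x y = p x y \<ominus> p y x"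
  shows "lie_algebra K L br"
proof -
  interpret module K L by fact
  have diff_right: "p x (y \<ominus> z) = p x y \<ominus> p x z"
    if "x \<in> carrier L" "y \<in> carrier L" "z \<in> carrier L" for x y z
  proof -
    have "p x (y \<ominus> z) \<oplus> p x z = p x (y \<ominus> z \<oplus> z)"
      using that by (simp add: add_right)
    also have "y \<ominus> z \<oplus> z = y"
      using that by algebra
    finally have "p x y \<ominus> p x z = (p x (y \<ominus> z) \<oplus> p x z) \<ominus> p x z"
      by simp
    also have "\<dots> = p x (y \<ominus> z)"
      using that closed[of x "y \<ominus> z"] closed[of x z] by (simp, algebra)
    finally show ?thesis by simp
  qed
  show ?thesis
  proof (unfold_locales, goal_cases)
    case (1 x y)
    then show ?case by (simp add: br closed)
  next
    case (2 x y z)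
    then show ?case by (simp add: br add_left add_right closed add_diff_add)
  next
    case (3 x y z)
    then show ?case by (simp add: br add_left add_right closed add_diff_add)
  next
    case (4 k x y)
    then show ?case
      by (simp add: br smult_left smult_right closed a_minus_def smult_r_distr smult_r_minus)
  next
    case (5 k x y)
    then show ?case
      by (simp add: br smult_left smult_right closed a_minus_def smult_r_distr smult_r_minus)
  next
    case (6 x)
    then show ?case by (simp add: br closed a_minus_def M.r_neg)
  next
    case (7 x y z)
    then show ?case
      by (simp add: br left_symmetric diff_right closed left_symmetric_jacobi_sum)
  qed
qed

section \<open>Restriction of scalars and modules of linear maps\<close>

lemma restrict_scalars_simps [simp]:
  "carrier (restrict_scalars R L) = carrier L"
  "add (restrict_scalars R L) = add L"
  "zero (restrict_scalars R L) = zero L"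
  "smult (restrict_scalars R L) k x = (k \<odot>\<^bsub>R\<^esub> \<one>\<^bsub>R\<^esub>) \<odot>\<^bsub>L\<^esub> x"
  by (simp_all add: restrict_scalars_def)

lemma minus_restrict_scalars [simp]:
  "x \<ominus>\<^bsub>restrict_scalars R L\<^esub> y = x \<ominus>\<^bsub>L\<^esub> y"
  by (simp add: a_minus_def a_inv_def m_inv_def)

lemma module_restrict_scalars:
  assumes "algebra K R" "module R L"
  shows "module K (restrict_scalars R L)"
proof -
  interpret A: algebra K R by fact
  interpret L: module R L by fact
  show ?thesis
  proof (rule moduleI)
    show "abelian_group (restrict_scalars R L)"
      by (rule abelian_groupI) (auto simp: L.M.a_ac intro: L.l_neg)
  next
    fix a b x assume a: "a \<in> carrier K" "b \<in> carrier K" "x \<in> carrier (restrict_scalars R L)"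
    have "(a \<otimes>\<^bsub>K\<^esub> b) \<odot>\<^bsub>R\<^esub> \<one>\<^bsub>R\<^esub> = (a \<odot>\<^bsub>R\<^esub> \<one>\<^bsub>R\<^esub>) \<otimes>\<^bsub>R\<^esub> (b \<odot>\<^bsub>R\<^esub> \<one>\<^bsub>R\<^esub>)"
      using a by (simp add: A.smult_assoc2 A.smult_assoc1)
    then show "(a \<otimes>\<^bsub>K\<^esub> b) \<odot>\<^bsub>restrict_scalars R L\<^esub> x =
        a \<odot>\<^bsub>restrict_scalars R L\<^esub> (b \<odot>\<^bsub>restrict_scalars R L\<^esub> x)"
      using a by (simp add: L.smult_assoc1)
  qed (auto simp: A.smult_l_distr L.smult_l_distr L.smult_r_distr intro: A.R_cring)
qed

lemma regular_module_simps [simp]: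
  "carrier (regular_module R) = carrier R"
  "add (regular_module R) = add R"
  "zero (regular_module R) = zero R"
  "smult (regular_module R) = mult R"
  by (simp_all add: regular_module_def)

lemma (in cring) module_regular_module: "module R (regular_module R)"
  by (rule moduleI, rule is_cring, rule abelian_groupI)
    (auto simp: a_ac m_assoc l_distr r_distr intro: l_neg)

lemma hom_module_simps [simp]:
  "carrier (hom_module R M N) = linear_maps R M N \<inter> extensional (carrier M)"
  "add (hom_module R M N) f g = (\<lambda>x \<in> carrier M. f x \<oplus>\<^bsub>N\<^esub> g x)"
  "zero (hom_module R M N) = (\<lambda>x \<in> carrier M. \<zero>\<^bsub>N\<^esub>)"
  "smult (hom_module R M N) r f = (\<lambda>x \<in> carrier M. r \<odot>\<^bsub>N\<^esub> f x)"
  by (simp_all add: hom_module_def)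

lemma linear_mapsD:
  assumes "f \<in> linear_maps R M N"
  shows "x \<in> carrier M \<Longrightarrow> f x \<in> carrier N"
    and "\<lbrakk>x \<in> carrier M; y \<in> carrier M\<rbrakk> \<Longrightarrow> f (x \<oplus>\<^bsub>M\<^esub> y) = f x \<oplus>\<^bsub>N\<^esub> f y"
    and "\<lbrakk>r \<in> carrier R; x \<in> carrier M\<rbrakk> \<Longrightarrow> f (r \<odot>\<^bsub>M\<^esub> x) = r \<odot>\<^bsub>N\<^esub> f x"
  using assms by (auto simp: linear_maps_def)

lemma linear_mapsI:
  assumes "\<And>x. x \<in> carrier M \<Longrightarrow> f x \<in> carrier N"
    and "\<And>x y. \<lbrakk>x \<in> carrier M; y \<in> carrier M\<rbrakk> \<Longrightarrow> f (x \<oplus>\<^bsub>M\<^esub> y) = f x \<oplus>\<^bsub>N\<^esub> f y"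
    and "\<And>r x. \<lbrakk>r \<in> carrier R; x \<in> carrier M\<rbrakk> \<Longrightarrow> f (r \<odot>\<^bsub>M\<^esub> x) = r \<odot>\<^bsub>N\<^esub> f x"
  shows "f \<in> linear_maps R M N"
  using assms by (auto simp: linear_maps_def)

text \<open>
  All module laws are inherited pointwise from \<open>N\<close>. Closure of \<open>M\<close> under its operations makes pointwise
  sums and multiples linear: these functions are undefined outside the carrier of \<open>M\<close>, so linearity
  needs their values at \<open>x \<oplus> y\<close> and \<open>r \<odot> x\<close> to be the pointwise ones.
\<close>

lemma module_hom_module:
  assumes "module R N"
    and M_add: "\<And>x y. \<lbrakk>x \<in> carrier M; y \<in> carrier M\<rbrakk> \<Longrightarrow> x \<oplus>\<^bsub>M\<^esub> y \<in> carrier M"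
    and M_smult: "\<And>r x. \<lbrakk>r \<in> carrier R; x \<in> carrier M\<rbrakk> \<Longrightarrow> r \<odot>\<^bsub>M\<^esub> x \<in> carrier M"
  shows "module R (hom_module R M N)"
proof -
  interpret N: module R N by fact
  let ?H = "hom_module R M N"
  note lin = linear_mapsD[where R = R and M = M and N = N]
  have restrict_in: "restrict f (carrier M) \<in> carrier ?H"
    if "\<And>x. x \<in> carrier M \<Longrightarrow> f x \<in> carrier N"
      "\<And>x y. \<lbrakk>x \<in> carrier M; y \<in> carrier M\<rbrakk> \<Longrightarrow> f (x \<oplus>\<^bsub>M\<^esub> y) = f x \<oplus>\<^bsub>N\<^esub> f y"
      "\<And>r x. \<lbrakk>r \<in> carrier R; x \<in> carrier M\<rbrakk> \<Longrightarrow> f (r \<odot>\<^bsub>M\<^esub> x) = r \<odot>\<^bsub>N\<^esub> f x" for f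
    unfolding hom_module_simps
    by (intro IntI linear_mapsI restrict_extensional) (simp_all add: that M_add M_smult)
  have eqI: "f = g"
    if "f \<in> carrier ?H" "g \<in> carrier ?H" "\<And>x. x \<in> carrier M \<Longrightarrow> f x = g x" for f g
    using that by (intro extensionalityI[where A = "carrier M"]) simp_all
  have add: "f \<oplus>\<^bsub>?H\<^esub> g \<in> carrier ?H" if "f \<in> carrier ?H" "g \<in> carrier ?H" for f g
    unfolding hom_module_simps(2)
    by (rule restrict_in) (use that in \<open>simp_all add: lin N.smult_r_distr N.add_add_swap\<close>)
  have smult: "r \<odot>\<^bsub>?H\<^esub> f \<in> carrier ?H" if r: "r \<in> carrier R" and f: "f \<in> carrier ?H" for r f
    unfolding hom_module_simps(4)
  proof (rule restrict_in)
    fix s x assume "s \<in> carrier R" "x \<in> carrier M"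
    then show "r \<odot>\<^bsub>N\<^esub> f (s \<odot>\<^bsub>M\<^esub> x) = s \<odot>\<^bsub>N\<^esub> (r \<odot>\<^bsub>N\<^esub> f x)"
      using r f by (simp add: lin N.smult_assoc1[symmetric] N.R.m_comm)
  qed (use r f in \<open>simp_all add: lin N.smult_r_distr\<close>)
  have zero: "\<zero>\<^bsub>?H\<^esub> \<in> carrier ?H"
    unfolding hom_module_simps(3) by (rule restrict_in) simp_all
  have neg: "\<exists>g \<in> carrier ?H. g \<oplus>\<^bsub>?H\<^esub> f = \<zero>\<^bsub>?H\<^esub>" if f: "f \<in> carrier ?H" for f
  proof
    show minus_f: "(\<lambda>x \<in> carrier M. \<ominus>\<^bsub>N\<^esub> f x) \<in> carrier ?H"
      by (rule restrict_in) (use f in \<open>simp_all add: lin N.M.minus_add N.smult_r_minus\<close>)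
    show "(\<lambda>x \<in> carrier M. \<ominus>\<^bsub>N\<^esub> f x) \<oplus>\<^bsub>?H\<^esub> f = \<zero>\<^bsub>?H\<^esub>"
      by (rule eqI[OF add[OF minus_f f] zero]) (use f in \<open>simp add: lin N.M.l_neg\<close>)
  qed
  show ?thesis
  proof (rule moduleI)
    show "abelian_group ?H"
    proof (rule abelian_groupI)
      fix f g h assume "f \<in> carrier ?H" "g \<in> carrier ?H" "h \<in> carrier ?H"
      then show "f \<oplus>\<^bsub>?H\<^esub> g \<oplus>\<^bsub>?H\<^esub> h = f \<oplus>\<^bsub>?H\<^esub> (g \<oplus>\<^bsub>?H\<^esub> h)"
        by (intro eqI add) (simp_all add: lin N.M.a_assoc)
    next
      fix f g assume "f \<in> carrier ?H" "g \<in> carrier ?H"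
      then show "f \<oplus>\<^bsub>?H\<^esub> g = g \<oplus>\<^bsub>?H\<^esub> f"
        by (intro eqI add) (simp_all add: lin N.M.a_comm)
    next
      fix f assume "f \<in> carrier ?H"
      then show "\<zero>\<^bsub>?H\<^esub> \<oplus>\<^bsub>?H\<^esub> f = f"
        by (intro eqI add zero) (simp_all add: lin)
    qed (fact add zero neg)+
  next
    fix f assume "f \<in> carrier ?H"
    then show "\<one>\<^bsub>R\<^esub> \<odot>\<^bsub>?H\<^esub> f = f"
      by (intro eqI smult N.R.one_closed) (simp_all add: lin)
  next
    fix r s f assume "r \<in> carrier R" "s \<in> carrier R" "f \<in> carrier ?H"
    then show "(r \<oplus>\<^bsub>R\<^esub> s) \<odot>\<^bsub>?H\<^esub> f = r \<odot>\<^bsub>?H\<^esub> f \<oplus>\<^bsub>?H\<^esub> s \<odot>\<^bsub>?H\<^esub> f"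
      and "(r \<otimes>\<^bsub>R\<^esub> s) \<odot>\<^bsub>?H\<^esub> f = r \<odot>\<^bsub>?H\<^esub> (s \<odot>\<^bsub>?H\<^esub> f)"
      by (intro eqI smult add N.R.a_closed N.R.m_closed;
          simp add: lin N.smult_l_distr N.smult_assoc1)+
  next
    fix r f g assume "r \<in> carrier R" "f \<in> carrier ?H" "g \<in> carrier ?H"
    then show "r \<odot>\<^bsub>?H\<^esub> (f \<oplus>\<^bsub>?H\<^esub> g) = r \<odot>\<^bsub>?H\<^esub> f \<oplus>\<^bsub>?H\<^esub> r \<odot>\<^bsub>?H\<^esub> g"
      by (intro eqI smult add; simp add: lin N.smult_r_distr)
  qed (fact smult N.R.is_cring)+
qed

text \<open>
  The inverse of the abelian group of linear maps is defined by a description operator, so the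
  difference is evaluated through the equation \<open>(f - g) + g = f\<close>.
\<close>

lemma minus_hom_module_apply:
  assumes "module R N" "module R (hom_module R M N)"
    and f: "f \<in> carrier (hom_module R M N)" and g: "g \<in> carrier (hom_module R M N)"
    and x: "x \<in> carrier M"
  shows "(f \<ominus>\<^bsub>hom_module R M N\<^esub> g) x = f x \<ominus>\<^bsub>N\<^esub> g x"
proof -
  interpret N: module R N by fact
  interpret H: module R "hom_module R M N" by fact
  let ?d = "f \<ominus>\<^bsub>hom_module R M N\<^esub> g"
  have d: "?d \<in> carrier (hom_module R M N)"
    using f g by (rule H.M.minus_closed)
  have in_N: "?d x \<in> carrier N" "f x \<in> carrier N" "g x \<in> carrier N"
    using d f g x by (simp_all add: linear_mapsD(1)[where R = R and M = M])
  have "?d \<oplus>\<^bsub>hom_module R M N\<^esub> g = f"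
    using f g by (simp only: a_minus_def H.M.a_assoc H.M.l_neg H.M.a_inv_closed H.M.r_zero)
  then have "f x = (?d \<oplus>\<^bsub>hom_module R M N\<^esub> g) x"
    by (rule arg_cong[symmetric])
  also have "\<dots> = ?d x \<oplus>\<^bsub>N\<^esub> g x"
    using x by simp
  finally have "f x \<ominus>\<^bsub>N\<^esub> g x = ?d x \<oplus>\<^bsub>N\<^esub> g x \<ominus>\<^bsub>N\<^esub> g x"
    by simp
  also have "\<dots> = ?d x"
    using in_N by (simp only: a_minus_def N.M.a_assoc N.M.r_neg N.M.a_inv_closed N.M.r_zero)
  finally show ?thesis by simp
qed

section \<open>Flat torsion-free connections\<close>

lemma Der_simps [simp]:
  "carrier (Der K R) = derivations K R"
  "add (Der K R) D E = (\<lambda>r \<in> carrier R. D r \<oplus>\<^bsub>R\<^esub> E r)"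
  "smult (Der K R) s D = (\<lambda>r \<in> carrier R. s \<otimes>\<^bsub>R\<^esub> D r)"
  by (simp_all add: Der_def)

text \<open>
  Here \<open>nabla x y\<close> is the covariant derivative of \<open>y\<close> along \<open>x\<close>, and \<open>flat\<close> is at the same time the
  left symmetry of \<open>nabla\<close>. Since \<open>nabla\<close> is \<open>R\<close>-linear only in its first argument, the bracket is
  bilinear over \<open>K\<close> alone: a derivation annihilates the scalars \<open>k \<cdot> 1\<close>, so the extra term of the product
  rule disappears for them.
\<close>

lemma lie_rinehart_algebra_of_flat_connection:
  fixes R :: "('k, 'r, 'x) module_scheme" and L :: "('r, 'l, 'y) module_scheme" (structure)
  assumes "algebra K R" "module R L"
    and anchor: "\<rho> \<in> linear_maps R L (Der K R)"
    and closed: "\<And>x y. \<lbrakk>x \<in> carrier L; y \<in> carrier L\<rbrakk> \<Longrightarrow> nabla x y \<in> carrier L"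
    and add_left: "\<And>x y z. \<lbrakk>x \<in> carrier L; y \<in> carrier L; z \<in> carrier L\<rbrakk>
      \<Longrightarrow> nabla (x \<oplus> y) z = nabla x z \<oplus> nabla y z"
    and add_right: "\<And>x y z. \<lbrakk>x \<in> carrier L; y \<in> carrier L; z \<in> carrier L\<rbrakk>
      \<Longrightarrow> nabla x (y \<oplus> z) = nabla x y \<oplus> nabla x z"
    and smult_left: "\<And>r x y. \<lbrakk>r \<in> carrier R; x \<in> carrier L; y \<in> carrier L\<rbrakk>
      \<Longrightarrow> nabla (r \<odot> x) y = r \<odot> nabla x y"
    and smult_right: "\<And>r x y. \<lbrakk>r \<in> carrier R; x \<in> carrier L; y \<in> carrier L\<rbrakk>
      \<Longrightarrow> nabla x (r \<odot> y) = r \<odot> nabla x y \<oplus> \<rho> x r \<odot> y"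
    and flat: "\<And>x y z. \<lbrakk>x \<in> carrier L; y \<in> carrier L; z \<in> carrier L\<rbrakk>
      \<Longrightarrow> nabla (nabla x y \<ominus> nabla y x) z = nabla x (nabla y z) \<ominus> nabla y (nabla x z)"
    and anchor_commutator: "\<And>x y. \<lbrakk>x \<in> carrier L; y \<in> carrier L\<rbrakk>
      \<Longrightarrow> \<rho> (nabla x y \<ominus> nabla y x) = commutator R (\<rho> x) (\<rho> y)"
    and br: "\<And>x y. \<lbrakk>x \<in> carrier L; y \<in> carrier L\<rbrakk> \<Longrightarrow> br x y = nabla x y \<ominus> nabla y x"
  shows "lie_rinehart_algebra K R L br \<rho>"
proof -
  interpret A: algebra K R by fact
  interpret L: module R L by fact
  have anchor_closed: "\<rho> x \<in> derivations K R" if "x \<in> carrier L" for x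
    using linear_mapsD(1)[OF anchor that] by simp
  have kills_scalars: "D (k \<odot>\<^bsub>R\<^esub> \<one>\<^bsub>R\<^esub>) = \<zero>\<^bsub>R\<^esub>"
    if "D \<in> derivations K R" "k \<in> carrier K" for D k
  proof -
    have lin: "D \<in> linear_maps K R R" and
      mult: "D (\<one>\<^bsub>R\<^esub> \<otimes>\<^bsub>R\<^esub> \<one>\<^bsub>R\<^esub>) = D \<one>\<^bsub>R\<^esub> \<otimes>\<^bsub>R\<^esub> \<one>\<^bsub>R\<^esub> \<oplus>\<^bsub>R\<^esub> \<one>\<^bsub>R\<^esub> \<otimes>\<^bsub>R\<^esub> D \<one>\<^bsub>R\<^esub>"
      using that(1) unfolding derivations_def by blast+
    have "D \<one>\<^bsub>R\<^esub> = \<zero>\<^bsub>R\<^esub>"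
      using mult linear_mapsD(1)[OF lin, of "\<one>\<^bsub>R\<^esub>"] by (simp add: A.M.add.l_cancel_one)
    then show ?thesis
      using that(2) by (simp add: linear_mapsD(3)[OF lin])
  qed
  have lie: "lie_algebra K (restrict_scalars R L) br"
  proof (rule lie_algebra_of_left_symmetric_product[where p = nabla])
    show "module K (restrict_scalars R L)"
      by (rule module_restrict_scalars) fact+
  qed (simp_all add: closed add_left add_right smult_left smult_right flat br
      kills_scalars anchor_closed)
  have "lie_rinehart_algebra_axioms K R L br \<rho>"
  proof
    fix r x y assume r: "r \<in> carrier R" and x: "x \<in> carrier L" and y: "y \<in> carrier L"
    have "\<rho> x r \<in> carrier R"
      using anchor_closed[OF x] r by (auto simp: derivations_def linear_maps_def)
    with r x y have atoms: "r \<odot> nabla x y \<in> carrier L" "r \<odot> nabla y x \<in> carrier L" "\<rho> x r \<odot> y \<in> carrier L"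
      by (simp_all add: closed)
    have "br x (r \<odot> y) = r \<odot> nabla x y \<oplus> \<rho> x r \<odot> y \<ominus> r \<odot> nabla y x"
      using r x y by (simp add: br smult_left smult_right)
    also have "\<dots> = r \<odot> nabla x y \<ominus> r \<odot> nabla y x \<oplus> \<rho> x r \<odot> y"
      using atoms by algebra
    also have "r \<odot> nabla x y \<ominus> r \<odot> nabla y x = r \<odot> br x y"
      using r x y by (simp add: br closed a_minus_def L.smult_r_distr L.smult_r_minus)
    finally show "br x (r \<odot> y) = r \<odot> br x y \<oplus> \<rho> x r \<odot> y" .
  qed (use anchor anchor_commutator br in simp_all)
  with \<open>algebra K R\<close> \<open>module R L\<close> lie show ?thesis
    by (rule lie_rinehart_algebra.intro)
qed

section \<open>Derivations, 1-forms and the Lie derivative\<close>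

locale vector_fields = A: algebra K R
  for K :: "('k, 'z) ring_scheme" and R :: "('k, 'r, 'x) module_scheme" (structure)
begin

abbreviation \<Omega> where "\<Omega> \<equiv> Omega1 K R"

lemma derivation_closed:
  "\<lbrakk>D \<in> derivations K R; r \<in> carrier R\<rbrakk> \<Longrightarrow> D r \<in> carrier R"
  by (auto simp: derivations_def linear_maps_def)

lemma derivation_add:
  "\<lbrakk>D \<in> derivations K R; r \<in> carrier R; s \<in> carrier R\<rbrakk> \<Longrightarrow> D (r \<oplus> s) = D r \<oplus> D s"
  by (auto simp: derivations_def linear_maps_def)

lemma derivation_scalar:
  "\<lbrakk>D \<in> derivations K R; k \<in> carrier K; r \<in> carrier R\<rbrakk>
    \<Longrightarrow> D (k \<odot> r) = k \<odot> D r"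
  by (auto simp: derivations_def linear_maps_def)

lemma derivation_mult:
  "\<lbrakk>D \<in> derivations K R; r \<in> carrier R; s \<in> carrier R\<rbrakk>
    \<Longrightarrow> D (r \<otimes> s) = D r \<otimes> s \<oplus> r \<otimes> D s"
  by (auto simp: derivations_def)

lemma derivation_zero:
  assumes D: "D \<in> derivations K R"
  shows "D \<zero> = \<zero>"
  using derivation_add[OF D, of \<zero> \<zero>] derivation_closed[OF D, of \<zero>]
  by (simp add: A.M.add.l_cancel_one)

lemma derivation_minus:
  assumes D: "D \<in> derivations K R" and r: "r \<in> carrier R"
  shows "D (\<ominus> r) = \<ominus> D r"
proof -
  have "D (\<ominus> r) \<oplus> D r = \<zero>"
    using derivation_add[OF D, of "\<ominus> r" r] derivation_zero[OF D] r by (simp add: A.M.l_neg)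
  then show ?thesis
    using D r by (simp add: A.M.minus_equality derivation_closed)
qed

lemma derivation_diff:
  "\<lbrakk>D \<in> derivations K R; r \<in> carrier R; s \<in> carrier R\<rbrakk> \<Longrightarrow> D (r \<ominus> s) = D r \<ominus> D s"
  by (simp add: a_minus_def derivation_add derivation_minus)

lemmas derivation_rules =
  derivation_closed derivation_add derivation_mult derivation_minus derivation_diff

lemma derivationsI:
  assumes "\<And>r. r \<in> carrier R \<Longrightarrow> D r \<in> carrier R"
    and "\<And>r s. \<lbrakk>r \<in> carrier R; s \<in> carrier R\<rbrakk> \<Longrightarrow> D (r \<oplus> s) = D r \<oplus> D s"
    and "\<And>k r. \<lbrakk>k \<in> carrier K; r \<in> carrier R\<rbrakk> \<Longrightarrow> D (k \<odot> r) = k \<odot> D r"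
    and "\<And>r s. \<lbrakk>r \<in> carrier R; s \<in> carrier R\<rbrakk> \<Longrightarrow> D (r \<otimes> s) = D r \<otimes> s \<oplus> r \<otimes> D s"
  shows "restrict D (carrier R) \<in> derivations K R"
  using assms by (auto simp: derivations_def intro!: linear_mapsI)

lemma derivation_eqI:
  assumes "D \<in> derivations K R" "E \<in> derivations K R" "\<And>r. r \<in> carrier R \<Longrightarrow> D r = E r"
  shows "D = E"
  using assms by (intro extensionalityI[where A = "carrier R"]) (auto simp: derivations_def)

lemma Der_add_closed:
  assumes D: "D \<in> derivations K R" and E: "E \<in> derivations K R"
  shows "D \<oplus>\<^bsub>Der K R\<^esub> E \<in> derivations K R"
  unfolding Der_simps
proof (rule derivationsI)
  fix r s assume "r \<in> carrier R" "s \<in> carrier R"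
  moreover from this D E have "D r \<in> carrier R" "D s \<in> carrier R" "E r \<in> carrier R" "E s \<in> carrier R"
    by (simp_all add: derivation_closed)
  ultimately show "D (r \<oplus> s) \<oplus> E (r \<oplus> s) = D r \<oplus> E r \<oplus> (D s \<oplus> E s)"
    and "D (r \<otimes> s) \<oplus> E (r \<otimes> s) = (D r \<oplus> E r) \<otimes> s \<oplus> r \<otimes> (D s \<oplus> E s)"
    using D E by (simp_all (no_asm_simp) add: derivation_rules, algebra, algebra)
qed (use D E in \<open>simp_all add: derivation_closed derivation_scalar A.smult_r_distr\<close>)

lemma Der_smult_closed:
  assumes t: "t \<in> carrier R" and D: "D \<in> derivations K R"
  shows "t \<odot>\<^bsub>Der K R\<^esub> D \<in> derivations K R"
  unfolding Der_simps
proof (rule derivationsI)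
  fix r s assume "r \<in> carrier R" "s \<in> carrier R"
  moreover from this D have "D r \<in> carrier R" "D s \<in> carrier R"
    by (simp_all add: derivation_closed)
  ultimately show "t \<otimes> D (r \<oplus> s) = t \<otimes> D r \<oplus> t \<otimes> D s"
    and "t \<otimes> D (r \<otimes> s) = t \<otimes> D r \<otimes> s \<oplus> r \<otimes> (t \<otimes> D s)"
    using t D by (simp_all (no_asm_simp) add: derivation_rules, algebra, algebra)
next
  fix k r assume "k \<in> carrier K" "r \<in> carrier R"
  then show "t \<otimes> D (k \<odot> r) = k \<odot> (t \<otimes> D r)"
    using t D by (simp add: derivation_closed derivation_scalar A.smult_assoc2 A.m_comm[of t])
qed (use t D in \<open>simp add: derivation_closed\<close>)

lemma commutator_apply: "r \<in> carrier R \<Longrightarrow> commutator R D E r = D (E r) \<ominus> E (D r)"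
  by (simp add: commutator_def)

lemma commutator_closed:
  assumes D: "D \<in> derivations K R" and E: "E \<in> derivations K R"
  shows "commutator R D E \<in> derivations K R"
  unfolding commutator_def
proof (rule derivationsI)
  fix r s assume "r \<in> carrier R" "s \<in> carrier R"
  moreover from this D E have
    "D r \<in> carrier R" "D s \<in> carrier R" "E r \<in> carrier R" "E s \<in> carrier R"
    "D (E r) \<in> carrier R" "D (E s) \<in> carrier R" "E (D r) \<in> carrier R" "E (D s) \<in> carrier R"
    by (simp_all add: derivation_closed)
  ultimately show "D (E (r \<oplus> s)) \<ominus> E (D (r \<oplus> s)) = D (E r) \<ominus> E (D r) \<oplus> (D (E s) \<ominus> E (D s))"
    and "D (E (r \<otimes> s)) \<ominus> E (D (r \<otimes> s)) =
      (D (E r) \<ominus> E (D r)) \<otimes> s \<oplus> r \<otimes> (D (E s) \<ominus> E (D s))"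
    using D E by (simp_all (no_asm_simp) add: derivation_rules, algebra, algebra)
qed (use D E in \<open>simp_all add: derivation_closed derivation_scalar a_minus_def
    A.smult_r_distr A.smult_r_minus\<close>)

lemma commutator_add_right:
  assumes D: "D \<in> derivations K R" and E: "E \<in> derivations K R" and F: "F \<in> derivations K R"
  shows "commutator R D (E \<oplus>\<^bsub>Der K R\<^esub> F) = commutator R D E \<oplus>\<^bsub>Der K R\<^esub> commutator R D F"
proof (rule derivation_eqI)
  fix r assume "r \<in> carrier R"
  moreover from this D E F have "D r \<in> carrier R" "D (E r) \<in> carrier R" "E (D r) \<in> carrier R"
    "D (F r) \<in> carrier R" "F (D r) \<in> carrier R" "E r \<in> carrier R" "F r \<in> carrier R"
    by (simp_all add: derivation_closed)
  ultimately show "commutator R D (E \<oplus>\<^bsub>Der K R\<^esub> F) r =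
      (commutator R D E \<oplus>\<^bsub>Der K R\<^esub> commutator R D F) r"
    using D by (simp (no_asm_simp) add: commutator_apply derivation_rules) algebra
qed (use assms in \<open>simp_all add: commutator_closed Der_add_closed del: Der_simps\<close>)

text \<open>
  The bracket of vector fields is not \<open>R\<close>-linear; the additional term is the reason why the Lie
  derivative of a form is again \<open>R\<close>-linear, as it cancels against \<open>X\<close> applied to the coefficient.
\<close>

lemma commutator_smult_right:
  assumes D: "D \<in> derivations K R" and t: "t \<in> carrier R" and E: "E \<in> derivations K R"
  shows "commutator R D (t \<odot>\<^bsub>Der K R\<^esub> E) =
    D t \<odot>\<^bsub>Der K R\<^esub> E \<oplus>\<^bsub>Der K R\<^esub> t \<odot>\<^bsub>Der K R\<^esub> commutator R D E"
proof (rule derivation_eqI)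
  fix r assume "r \<in> carrier R"
  moreover from this D E t have "D r \<in> carrier R" "D (E r) \<in> carrier R" "E (D r) \<in> carrier R"
    "E r \<in> carrier R" "D t \<in> carrier R"
    by (simp_all add: derivation_closed)
  ultimately show "commutator R D (t \<odot>\<^bsub>Der K R\<^esub> E) r =
      (D t \<odot>\<^bsub>Der K R\<^esub> E \<oplus>\<^bsub>Der K R\<^esub> t \<odot>\<^bsub>Der K R\<^esub> commutator R D E) r"
    using t D by (simp (no_asm_simp) add: commutator_apply derivation_rules) algebra
qed (use assms in \<open>simp_all add: commutator_closed Der_add_closed Der_smult_closed
    derivation_closed del: Der_simps\<close>)

lemma module_Omega1: "module R \<Omega>"
  unfolding Omega1_def
  by (rule module_hom_module)
    (simp_all add: A.module_regular_module Der_add_closed Der_smult_closed del: Der_simps(2,3))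

lemma form_closed: "\<lbrakk>\<alpha> \<in> carrier \<Omega>; Z \<in> derivations K R\<rbrakk> \<Longrightarrow> \<alpha> Z \<in> carrier R"
  by (auto simp: Omega1_def linear_maps_def)

lemma form_add:
  "\<lbrakk>\<alpha> \<in> carrier \<Omega>; Z \<in> derivations K R; W \<in> derivations K R\<rbrakk>
    \<Longrightarrow> \<alpha> (Z \<oplus>\<^bsub>Der K R\<^esub> W) = \<alpha> Z \<oplus> \<alpha> W"
  by (auto simp: Omega1_def linear_maps_def)

lemma form_smult:
  "\<lbrakk>\<alpha> \<in> carrier \<Omega>; r \<in> carrier R; Z \<in> derivations K R\<rbrakk>
    \<Longrightarrow> \<alpha> (r \<odot>\<^bsub>Der K R\<^esub> Z) = r \<otimes> \<alpha> Z"
  by (auto simp: Omega1_def linear_maps_def)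

lemma form_eqI:
  assumes "\<alpha> \<in> carrier \<Omega>" "\<beta> \<in> carrier \<Omega>" "\<And>Z. Z \<in> derivations K R \<Longrightarrow> \<alpha> Z = \<beta> Z"
  shows "\<alpha> = \<beta>"
  using assms by (intro extensionalityI[where A = "derivations K R"]) (auto simp: Omega1_def)

lemma Omega1_add_apply: "Z \<in> derivations K R \<Longrightarrow> (\<alpha> \<oplus>\<^bsub>\<Omega>\<^esub> \<beta>) Z = \<alpha> Z \<oplus> \<beta> Z"
  by (simp add: Omega1_def)

lemma Omega1_smult_apply: "Z \<in> derivations K R \<Longrightarrow> (r \<odot>\<^bsub>\<Omega>\<^esub> \<alpha>) Z = r \<otimes> \<alpha> Z"
  by (simp add: Omega1_def)

lemma Omega1_diff_apply:
  assumes "\<alpha> \<in> carrier \<Omega>" "\<beta> \<in> carrier \<Omega>" "Z \<in> derivations K R"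
  shows "(\<alpha> \<ominus>\<^bsub>\<Omega>\<^esub> \<beta>) Z = \<alpha> Z \<ominus> \<beta> Z"
proof -
  have "x \<ominus>\<^bsub>regular_module R\<^esub> y = x \<ominus> y" for x y
    by (simp add: a_minus_def a_inv_def m_inv_def)
  then show ?thesis
    using assms minus_hom_module_apply[OF A.module_regular_module, of "Der K R" \<alpha> \<beta> Z] module_Omega1
    by (simp add: Omega1_def)
qed

lemma lie_derivative_apply:
  "Z \<in> derivations K R \<Longrightarrow>
    lie_derivative K R X \<alpha> Z = X (\<alpha> Z) \<ominus> \<alpha> (commutator R X Z)"
  by (simp add: lie_derivative_def)

lemma lie_derivative_closed:
  assumes X: "X \<in> derivations K R" and \<alpha>: "\<alpha> \<in> carrier \<Omega>"
  shows "lie_derivative K R X \<alpha> \<in> carrier \<Omega>"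
proof -
  have "lie_derivative K R X \<alpha> \<in> linear_maps R (Der K R) (regular_module R)"
  proof (rule linear_mapsI, unfold Der_simps(1) regular_module_simps)
    fix Z assume "Z \<in> derivations K R"
    then show "lie_derivative K R X \<alpha> Z \<in> carrier R"
      using X \<alpha> by (simp add: lie_derivative_apply commutator_closed derivation_closed form_closed)
  next
    fix Z W assume ZW: "Z \<in> derivations K R" "W \<in> derivations K R"
    with X \<alpha> have "X (\<alpha> Z) \<in> carrier R" "X (\<alpha> W) \<in> carrier R"
      "\<alpha> (commutator R X Z) \<in> carrier R" "\<alpha> (commutator R X W) \<in> carrier R"
      by (simp_all add: commutator_closed derivation_closed form_closed)
    moreover have "lie_derivative K R X \<alpha> (Z \<oplus>\<^bsub>Der K R\<^esub> W) =
        X (\<alpha> Z) \<oplus> X (\<alpha> W) \<ominus> (\<alpha> (commutator R X Z) \<oplus> \<alpha> (commutator R X W))"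
      using X \<alpha> ZW by (simp add: lie_derivative_apply Der_add_closed commutator_add_right
          form_add form_closed derivation_add commutator_closed del: Der_simps(2,3))
    ultimately show "lie_derivative K R X \<alpha> (Z \<oplus>\<^bsub>Der K R\<^esub> W) =
        lie_derivative K R X \<alpha> Z \<oplus> lie_derivative K R X \<alpha> W"
      using ZW by (simp (no_asm_simp) add: lie_derivative_apply del: Der_simps(2,3)) algebra
  next
    fix r Z assume rZ: "r \<in> carrier R" "Z \<in> derivations K R"
    with X \<alpha> have "X (\<alpha> Z) \<in> carrier R" "\<alpha> Z \<in> carrier R" "X r \<in> carrier R"
      "\<alpha> (commutator R X Z) \<in> carrier R"
      by (simp_all add: commutator_closed derivation_closed form_closed)
    moreover have "lie_derivative K R X \<alpha> (r \<odot>\<^bsub>Der K R\<^esub> Z) =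
        X r \<otimes> \<alpha> Z \<oplus> r \<otimes> X (\<alpha> Z) \<ominus> (X r \<otimes> \<alpha> Z \<oplus> r \<otimes> \<alpha> (commutator R X Z))"
      using X \<alpha> rZ by (simp add: lie_derivative_apply Der_smult_closed commutator_smult_right
          form_add form_smult form_closed derivation_closed derivation_mult commutator_closed
          del: Der_simps(2,3))
    ultimately show "lie_derivative K R X \<alpha> (r \<odot>\<^bsub>Der K R\<^esub> Z) = r \<otimes> lie_derivative K R X \<alpha> Z"
      using rZ by (simp (no_asm_simp) add: lie_derivative_apply del: Der_simps(2,3)) algebra
  qed
  then show ?thesis
    by (simp add: Omega1_def lie_derivative_def)
qed

lemma lie_derivative_add:
  assumes X: "X \<in> derivations K R" and "\<alpha> \<in> carrier \<Omega>" "\<beta> \<in> carrier \<Omega>" "Z \<in> derivations K R"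
  shows "lie_derivative K R X (\<alpha> \<oplus>\<^bsub>\<Omega>\<^esub> \<beta>) Z = lie_derivative K R X \<alpha> Z \<oplus> lie_derivative K R X \<beta> Z"
  using assms by (simp add: lie_derivative_apply Omega1_add_apply commutator_closed
      derivation_closed derivation_add form_closed A.add_diff_add)

lemma lie_derivative_smult:
  assumes X: "X \<in> derivations K R" and r: "r \<in> carrier R"
    and \<alpha>: "\<alpha> \<in> carrier \<Omega>" and Z: "Z \<in> derivations K R"
  shows "lie_derivative K R X (r \<odot>\<^bsub>\<Omega>\<^esub> \<alpha>) Z = X r \<otimes> \<alpha> Z \<oplus> r \<otimes> lie_derivative K R X \<alpha> Z"
proof -
  have "X r \<in> carrier R" "\<alpha> Z \<in> carrier R" "X (\<alpha> Z) \<in> carrier R"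
    "\<alpha> (commutator R X Z) \<in> carrier R"
    using assms by (simp_all add: commutator_closed derivation_closed form_closed)
  moreover have "lie_derivative K R X (r \<odot>\<^bsub>\<Omega>\<^esub> \<alpha>) Z =
      X r \<otimes> \<alpha> Z \<oplus> r \<otimes> X (\<alpha> Z) \<ominus> r \<otimes> \<alpha> (commutator R X Z)"
    using assms by (simp add: lie_derivative_apply Omega1_smult_apply commutator_closed
        derivation_mult form_closed)
  ultimately show ?thesis
    using r by (simp (no_asm_simp) add: lie_derivative_apply Z) algebra
qed

lemma lie_derivative_diff:
  assumes X: "X \<in> derivations K R"
    and \<alpha>: "\<alpha> \<in> carrier \<Omega>" and \<beta>: "\<beta> \<in> carrier \<Omega>" and Z: "Z \<in> derivations K R"
  shows "lie_derivative K R X (\<alpha> \<ominus>\<^bsub>\<Omega>\<^esub> \<beta>) Z = lie_derivative K R X \<alpha> Z \<ominus> lie_derivative K R X \<beta> Z"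
proof -
  have "X (\<alpha> Z) \<in> carrier R" "X (\<beta> Z) \<in> carrier R"
    "\<alpha> (commutator R X Z) \<in> carrier R" "\<beta> (commutator R X Z) \<in> carrier R"
    using assms by (simp_all add: commutator_closed derivation_closed form_closed)
  moreover have "lie_derivative K R X (\<alpha> \<ominus>\<^bsub>\<Omega>\<^esub> \<beta>) Z =
      X (\<alpha> Z) \<ominus> X (\<beta> Z) \<ominus> (\<alpha> (commutator R X Z) \<ominus> \<beta> (commutator R X Z))"
    using assms by (simp add: lie_derivative_apply Omega1_diff_apply commutator_closed
        derivation_diff form_closed)
  ultimately show ?thesis
    by (simp (no_asm_simp) add: lie_derivative_apply Z) algebra
qed

end

section \<open>The flat connection of a pair of vector fields\<close>

locale double_commutator_pair = vector_fields K R
  for K :: "('k, 'z) ring_scheme" and R :: "('k, 'r, 'x) module_scheme" (structure) +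
  fixes X Y :: "'r \<Rightarrow> 'r" and c :: 'r
  assumes X: "X \<in> derivations K R" and Y: "Y \<in> derivations K R" and c: "c \<in> carrier R"
    and XXY: "commutator R X (commutator R X Y) = c \<odot>\<^bsub>Der K R\<^esub> Y"
begin

sublocale \<Omega>: module R \<Omega>
  by (rule module_Omega1)

abbreviation V where "V \<equiv> commutator R X Y"

abbreviation lie where "lie \<equiv> lie_derivative K R X"

definition nabla where
  "nabla \<alpha> \<beta> = \<alpha> Y \<odot>\<^bsub>\<Omega>\<^esub> lie \<beta> \<ominus>\<^bsub>\<Omega>\<^esub> \<alpha> V \<odot>\<^bsub>\<Omega>\<^esub> \<beta>"

lemma V: "V \<in> derivations K R"
  by (rule commutator_closed[OF X Y])

lemma lie_closed: "\<alpha> \<in> carrier \<Omega> \<Longrightarrow> lie \<alpha> \<in> carrier \<Omega>"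
  by (rule lie_derivative_closed[OF X])

lemmas values_closed = form_closed[OF _ Y] form_closed[OF _ V] derivation_closed[OF X] lie_closed

lemma nabla_closed:
  "\<lbrakk>\<alpha> \<in> carrier \<Omega>; \<beta> \<in> carrier \<Omega>\<rbrakk> \<Longrightarrow> nabla \<alpha> \<beta> \<in> carrier \<Omega>"
  by (simp add: nabla_def values_closed)

lemma nabla_apply:
  "\<lbrakk>\<alpha> \<in> carrier \<Omega>; \<beta> \<in> carrier \<Omega>; Z \<in> derivations K R\<rbrakk>
    \<Longrightarrow> nabla \<alpha> \<beta> Z = \<alpha> Y \<otimes> lie \<beta> Z \<ominus> \<alpha> V \<otimes> \<beta> Z"
  by (simp add: nabla_def values_closed Omega1_diff_apply Omega1_smult_apply)

lemma lie_at_Y: "lie \<alpha> Y = X (\<alpha> Y) \<ominus> \<alpha> V"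
  by (simp add: lie_derivative_apply Y)

lemma lie_at_V: "\<alpha> \<in> carrier \<Omega> \<Longrightarrow> lie \<alpha> V = X (\<alpha> V) \<ominus> c \<otimes> \<alpha> Y"
  by (simp add: lie_derivative_apply V XXY form_smult c Y del: Der_simps)

text \<open>
  The zeroth-order part of \<open>nabla\<close> is chosen for this: the term \<open>- \<beta> V\<close> of \<open>lie \<beta> Y\<close> contributes
  \<open>- \<alpha> Y \<otimes> \<beta> V\<close>, which cancels against the zeroth-order part of \<open>nabla \<beta> \<alpha>\<close>.
\<close>

lemma nabla_commutator_at_Y:
  assumes \<alpha>: "\<alpha> \<in> carrier \<Omega>" and \<beta>: "\<beta> \<in> carrier \<Omega>"
  shows "(nabla \<alpha> \<beta> \<ominus>\<^bsub>\<Omega>\<^esub> nabla \<beta> \<alpha>) Y = \<alpha> Y \<otimes> X (\<beta> Y) \<ominus> \<beta> Y \<otimes> X (\<alpha> Y)"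
proof -
  have "\<alpha> Y \<in> carrier R" "\<beta> Y \<in> carrier R" "X (\<alpha> Y) \<in> carrier R" "X (\<beta> Y) \<in> carrier R"
    "\<alpha> V \<in> carrier R" "\<beta> V \<in> carrier R"
    using assms by (simp_all add: values_closed)
  then show ?thesis
    by (simp (no_asm_simp) add: Omega1_diff_apply nabla_closed nabla_apply lie_at_Y \<alpha> \<beta> Y) algebra
qed

text \<open>
  The hypothesis on \<open>[X, [X, Y]]\<close> enters here, through \<open>lie_at_V\<close>: the term of \<open>nabla \<alpha> \<beta>\<close> that
  contains \<open>c\<close> is symmetric in the two forms, and so is the product of their values at \<open>V\<close>.
\<close>

lemma nabla_commutator_at_V:
  assumes \<alpha>: "\<alpha> \<in> carrier \<Omega>" and \<beta>: "\<beta> \<in> carrier \<Omega>"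
  shows "(nabla \<alpha> \<beta> \<ominus>\<^bsub>\<Omega>\<^esub> nabla \<beta> \<alpha>) V = \<alpha> Y \<otimes> X (\<beta> V) \<ominus> \<beta> Y \<otimes> X (\<alpha> V)"
proof -
  have "\<alpha> Y \<in> carrier R" "\<beta> Y \<in> carrier R" "X (\<alpha> V) \<in> carrier R" "X (\<beta> V) \<in> carrier R"
    "\<alpha> V \<in> carrier R" "\<beta> V \<in> carrier R"
    using assms by (simp_all add: values_closed)
  then show ?thesis
    using c by (simp (no_asm_simp) add: Omega1_diff_apply nabla_closed nabla_apply lie_at_V \<alpha> \<beta> V) algebra
qed

lemma lie_nabla:
  assumes \<alpha>: "\<alpha> \<in> carrier \<Omega>" and \<beta>: "\<beta> \<in> carrier \<Omega>" and Z: "Z \<in> derivations K R"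
  shows "lie (nabla \<alpha> \<beta>) Z =
    X (\<alpha> Y) \<otimes> lie \<beta> Z \<oplus> \<alpha> Y \<otimes> lie (lie \<beta>) Z \<ominus> (X (\<alpha> V) \<otimes> \<beta> Z \<oplus> \<alpha> V \<otimes> lie \<beta> Z)"
  using assms by (simp add: nabla_def lie_derivative_diff lie_derivative_smult X values_closed)

text \<open>
  The second-order terms of the commutator on the right cancel, so both sides apply a first-order
  operator in \<open>lie\<close> to \<open>\<gamma>\<close>; its coefficients are the values at \<open>Y\<close> and \<open>V\<close> of the form in the first
  argument on the left.
\<close>

lemma nabla_flat:
  assumes \<alpha>: "\<alpha> \<in> carrier \<Omega>" and \<beta>: "\<beta> \<in> carrier \<Omega>" and \<gamma>: "\<gamma> \<in> carrier \<Omega>"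
  shows "nabla (nabla \<alpha> \<beta> \<ominus>\<^bsub>\<Omega>\<^esub> nabla \<beta> \<alpha>) \<gamma> =
    nabla \<alpha> (nabla \<beta> \<gamma>) \<ominus>\<^bsub>\<Omega>\<^esub> nabla \<beta> (nabla \<alpha> \<gamma>)"
proof (rule form_eqI)
  fix Z assume Z: "Z \<in> derivations K R"
  have "\<alpha> Y \<in> carrier R" "\<beta> Y \<in> carrier R" "X (\<alpha> Y) \<in> carrier R" "X (\<beta> Y) \<in> carrier R"
    "\<alpha> V \<in> carrier R" "\<beta> V \<in> carrier R" "X (\<alpha> V) \<in> carrier R" "X (\<beta> V) \<in> carrier R"
    "\<gamma> Z \<in> carrier R" "lie \<gamma> Z \<in> carrier R" "lie (lie \<gamma>) Z \<in> carrier R"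
    using assms Z by (simp_all add: values_closed form_closed)
  then show "nabla (nabla \<alpha> \<beta> \<ominus>\<^bsub>\<Omega>\<^esub> nabla \<beta> \<alpha>) \<gamma> Z =
      (nabla \<alpha> (nabla \<beta> \<gamma>) \<ominus>\<^bsub>\<Omega>\<^esub> nabla \<beta> (nabla \<alpha> \<gamma>)) Z"
    by (simp (no_asm_simp) add: nabla_apply nabla_closed Omega1_diff_apply lie_nabla
        nabla_commutator_at_Y nabla_commutator_at_V \<alpha> \<beta> \<gamma> Z) (rule A.first_order_operator_commutator)
qed (simp_all add: nabla_closed assms)

lemma nabla_add_left:
  assumes \<alpha>: "\<alpha> \<in> carrier \<Omega>" and \<beta>: "\<beta> \<in> carrier \<Omega>" and \<gamma>: "\<gamma> \<in> carrier \<Omega>"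
  shows "nabla (\<alpha> \<oplus>\<^bsub>\<Omega>\<^esub> \<beta>) \<gamma> = nabla \<alpha> \<gamma> \<oplus>\<^bsub>\<Omega>\<^esub> nabla \<beta> \<gamma>"
proof -
  have "\<alpha> Y \<in> carrier R" "\<beta> Y \<in> carrier R" "\<alpha> V \<in> carrier R" "\<beta> V \<in> carrier R"
    using assms by (simp_all add: values_closed)
  then show ?thesis
    by (simp add: nabla_def Omega1_add_apply Y V \<Omega>.smult_l_distr \<Omega>.add_diff_add lie_closed \<gamma>)
qed

lemma nabla_add_right:
  assumes \<alpha>: "\<alpha> \<in> carrier \<Omega>" and \<beta>: "\<beta> \<in> carrier \<Omega>" and \<gamma>: "\<gamma> \<in> carrier \<Omega>"
  shows "nabla \<alpha> (\<beta> \<oplus>\<^bsub>\<Omega>\<^esub> \<gamma>) = nabla \<alpha> \<beta> \<oplus>\<^bsub>\<Omega>\<^esub> nabla \<alpha> \<gamma>"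
proof -
  have "lie (\<beta> \<oplus>\<^bsub>\<Omega>\<^esub> \<gamma>) = lie \<beta> \<oplus>\<^bsub>\<Omega>\<^esub> lie \<gamma>"
    by (rule form_eqI) (simp_all add: lie_closed \<beta> \<gamma> lie_derivative_add X Omega1_add_apply)
  moreover have "\<alpha> Y \<in> carrier R" "\<alpha> V \<in> carrier R"
    using assms by (simp_all add: values_closed)
  ultimately show ?thesis
    by (simp add: nabla_def \<Omega>.smult_r_distr \<Omega>.add_diff_add lie_closed \<beta> \<gamma>)
qed

lemma nabla_smult_left:
  assumes r: "r \<in> carrier R" and \<alpha>: "\<alpha> \<in> carrier \<Omega>" and \<beta>: "\<beta> \<in> carrier \<Omega>"
  shows "nabla (r \<odot>\<^bsub>\<Omega>\<^esub> \<alpha>) \<beta> = r \<odot>\<^bsub>\<Omega>\<^esub> nabla \<alpha> \<beta>"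
proof -
  have "\<alpha> Y \<in> carrier R" "\<alpha> V \<in> carrier R"
    using assms by (simp_all add: values_closed)
  then show ?thesis
    by (simp add: nabla_def Omega1_smult_apply Y V \<Omega>.smult_assoc1 a_minus_def
        \<Omega>.smult_r_distr \<Omega>.smult_r_minus lie_closed r \<beta>)
qed

lemma nabla_smult_right:
  assumes r: "r \<in> carrier R" and \<alpha>: "\<alpha> \<in> carrier \<Omega>" and \<beta>: "\<beta> \<in> carrier \<Omega>"
  shows "nabla \<alpha> (r \<odot>\<^bsub>\<Omega>\<^esub> \<beta>) =
    r \<odot>\<^bsub>\<Omega>\<^esub> nabla \<alpha> \<beta> \<oplus>\<^bsub>\<Omega>\<^esub> (\<alpha> Y \<odot>\<^bsub>Der K R\<^esub> X) r \<odot>\<^bsub>\<Omega>\<^esub> \<beta>"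
proof (rule form_eqI)
  fix Z assume Z: "Z \<in> derivations K R"
  have "\<alpha> Y \<in> carrier R" "\<alpha> V \<in> carrier R" "X r \<in> carrier R"
    "\<beta> Z \<in> carrier R" "lie \<beta> Z \<in> carrier R"
    using assms Z by (simp_all add: values_closed form_closed)
  then show "nabla \<alpha> (r \<odot>\<^bsub>\<Omega>\<^esub> \<beta>) Z =
      (r \<odot>\<^bsub>\<Omega>\<^esub> nabla \<alpha> \<beta> \<oplus>\<^bsub>\<Omega>\<^esub> (\<alpha> Y \<odot>\<^bsub>Der K R\<^esub> X) r \<odot>\<^bsub>\<Omega>\<^esub> \<beta>) Z"
    using r by (simp (no_asm_simp) add: nabla_apply Omega1_add_apply Omega1_smult_apply
        lie_derivative_smult X \<alpha> \<beta> Z) algebra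
qed (simp_all add: nabla_closed values_closed assms)

lemma anchor_linear:
  "(\<lambda>\<alpha>. \<alpha> Y \<odot>\<^bsub>Der K R\<^esub> X) \<in> linear_maps R \<Omega> (Der K R)"
proof (rule linear_mapsI)
  fix \<alpha> assume "\<alpha> \<in> carrier \<Omega>"
  then show "\<alpha> Y \<odot>\<^bsub>Der K R\<^esub> X \<in> carrier (Der K R)"
    by (simp add: Der_smult_closed X values_closed del: Der_simps(3))
next
  fix \<alpha> \<beta> assume "\<alpha> \<in> carrier \<Omega>" "\<beta> \<in> carrier \<Omega>"
  then show "(\<alpha> \<oplus>\<^bsub>\<Omega>\<^esub> \<beta>) Y \<odot>\<^bsub>Der K R\<^esub> X =
      \<alpha> Y \<odot>\<^bsub>Der K R\<^esub> X \<oplus>\<^bsub>Der K R\<^esub> \<beta> Y \<odot>\<^bsub>Der K R\<^esub> X"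
    by (auto simp: Omega1_add_apply Y values_closed A.l_distr)
next
  fix r \<alpha> assume "r \<in> carrier R" "\<alpha> \<in> carrier \<Omega>"
  then show "(r \<odot>\<^bsub>\<Omega>\<^esub> \<alpha>) Y \<odot>\<^bsub>Der K R\<^esub> X = r \<odot>\<^bsub>Der K R\<^esub> (\<alpha> Y \<odot>\<^bsub>Der K R\<^esub> X)"
    by (auto simp: Omega1_smult_apply Y values_closed A.m_assoc)
qed

lemma anchor_nabla_commutator:
  assumes \<alpha>: "\<alpha> \<in> carrier \<Omega>" and \<beta>: "\<beta> \<in> carrier \<Omega>"
  shows "(nabla \<alpha> \<beta> \<ominus>\<^bsub>\<Omega>\<^esub> nabla \<beta> \<alpha>) Y \<odot>\<^bsub>Der K R\<^esub> X =
    commutator R (\<alpha> Y \<odot>\<^bsub>Der K R\<^esub> X) (\<beta> Y \<odot>\<^bsub>Der K R\<^esub> X)"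
proof (rule derivation_eqI)
  have f: "\<alpha> Y \<in> carrier R" "\<beta> Y \<in> carrier R"
    using assms by (simp_all add: values_closed)
  then show "commutator R (\<alpha> Y \<odot>\<^bsub>Der K R\<^esub> X) (\<beta> Y \<odot>\<^bsub>Der K R\<^esub> X) \<in> derivations K R"
    by (simp add: commutator_closed Der_smult_closed X del: Der_simps)
  show "(nabla \<alpha> \<beta> \<ominus>\<^bsub>\<Omega>\<^esub> nabla \<beta> \<alpha>) Y \<odot>\<^bsub>Der K R\<^esub> X \<in> derivations K R"
    by (simp add: Der_smult_closed X values_closed nabla_closed assms del: Der_simps)
  fix r assume r: "r \<in> carrier R"
  have "X (\<alpha> Y) \<in> carrier R" "X (\<beta> Y) \<in> carrier R" "X r \<in> carrier R" "X (X r) \<in> carrier R"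
    using f r by (simp_all add: values_closed)
  with f show "((nabla \<alpha> \<beta> \<ominus>\<^bsub>\<Omega>\<^esub> nabla \<beta> \<alpha>) Y \<odot>\<^bsub>Der K R\<^esub> X) r =
      commutator R (\<alpha> Y \<odot>\<^bsub>Der K R\<^esub> X) (\<beta> Y \<odot>\<^bsub>Der K R\<^esub> X) r"
    by (simp (no_asm_simp) add: commutator_apply r nabla_commutator_at_Y derivation_mult X assms) algebra
qed

lemma lie_rinehart_algebra_Omega1:
  assumes br: "\<And>\<alpha> \<beta>. \<lbrakk>\<alpha> \<in> carrier \<Omega>; \<beta> \<in> carrier \<Omega>\<rbrakk> \<Longrightarrow> br \<alpha> \<beta> = nabla \<alpha> \<beta> \<ominus>\<^bsub>\<Omega>\<^esub> nabla \<beta> \<alpha>"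
  shows "lie_rinehart_algebra K R \<Omega> br (\<lambda>\<alpha>. \<alpha> Y \<odot>\<^bsub>Der K R\<^esub> X)"
  by (rule lie_rinehart_algebra_of_flat_connection[where nabla = nabla and
        \<rho> = "\<lambda>\<alpha>. \<alpha> Y \<odot>\<^bsub>Der K R\<^esub> X" and br = br and R = R and L = \<Omega> and K = K,
        OF A.algebra_axioms module_Omega1 anchor_linear nabla_closed nabla_add_left
        nabla_add_right nabla_smult_left nabla_smult_right nabla_flat anchor_nabla_commutator br])

end

theorem corollary4p19:
  fixes K :: "('k, 'z) ring_scheme"
    and R :: "('k, 'r, 'x) module_scheme"
    and X Y :: "'r \<Rightarrow> 'r"
  assumes field_K: "field K"
    and char_zero_K: "\<And>n::nat. n > 0 \<Longrightarrow> [n] \<cdot>\<^bsub>K\<^esub> \<one>\<^bsub>K\<^esub> \<noteq> \<zero>\<^bsub>K\<^esub>"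
    and algebra_R: "algebra K R"
    and X: "X \<in> carrier (Der K R)"
    and Y: "Y \<in> carrier (Der K R)"
    and XXY: "\<exists>c \<in> carrier R. commutator R X (commutator R X Y) = c \<odot>\<^bsub>Der K R\<^esub> Y"
  shows "lie_rinehart_algebra K R (Omega1 K R)
    (\<lambda>\<alpha>\<^sub>1 \<alpha>\<^sub>2. \<alpha>\<^sub>1 Y \<odot>\<^bsub>Omega1 K R\<^esub> lie_derivative K R X \<alpha>\<^sub>2
       \<ominus>\<^bsub>Omega1 K R\<^esub> \<alpha>\<^sub>2 Y \<odot>\<^bsub>Omega1 K R\<^esub> lie_derivative K R X \<alpha>\<^sub>1
       \<ominus>\<^bsub>Omega1 K R\<^esub> \<alpha>\<^sub>1 (commutator R X Y) \<odot>\<^bsub>Omega1 K R\<^esub> \<alpha>\<^sub>2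
       \<oplus>\<^bsub>Omega1 K R\<^esub> \<alpha>\<^sub>2 (commutator R X Y) \<odot>\<^bsub>Omega1 K R\<^esub> \<alpha>\<^sub>1)
    (\<lambda>\<alpha>. \<alpha> Y \<odot>\<^bsub>Der K R\<^esub> X)"
proof -
  obtain c where c: "c \<in> carrier R" "commutator R X (commutator R X Y) = c \<odot>\<^bsub>Der K R\<^esub> Y"
    using XXY by blast
  interpret algebra K R by (rule algebra_R)
  interpret double_commutator_pair K R X Y c
    by unfold_locales (use X Y c in simp_all)
  show ?thesis
    by (rule lie_rinehart_algebra_Omega1)
      (simp add: nabla_def values_closed \<Omega>.diff_diff_add)
qed

end
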